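(* Let $M\geq 1$ be an integer and let $\gamma:\mathbb{R}\to\mathbb{R}^2$ be a $2\pi$-periodic real-analytic curve that is regular ($\gamma'(t)\neq0$ for all $t$) and has length $\int_0^{2\pi}\|\gamma'(t)\|\,\mathrm{d}t=2\pi$, with Fourier expansion $$\gamma(t)=\Bigg(\sum_{j=0}^\infty a_j\cos(jt)+b_j\sin(jt),\ \sum_{j=0}^\infty \bar a_j\cos(jt)+\bar b_j\sin(jt)\Bigg)$$ such that $a_j=b_j=\bar a_j=\bar b_j=0$ whenever $j$ is an integer multiple of $M$. Let $\theta$ be a continuous turning angle of $\gamma$, i.e. $\gamma'(t)=\|\gamma'(t)\|\,\mathrm{e}^{i\theta(t)}$, and let $s\mapsto t(s)$, $s\in[0,2\pi]$, be the inverse of the arc-length function $t\mapsto\int_0^t\|\gamma'(u)\|\,\mathrm{d}u$ on $[0,2\pi]$. Then for every $\lambda\in\mathbb{R}$ the curve $$s\mapsto\int_0^s \mathrm{e}^{i\left(\theta(t(\sigma))+\lambda\cos(M\,t(\sigma))\right)}\,\mathrm{d}\sigma,\qquad s\in[0,2\pi],$$ is analytic and closed.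
   Context: $\mathbb{R}^2$ is identified with $\mathbb{C}$. The coefficients $a_j,b_j,\bar a_j,\bar b_j$ are real (the bar is only notation and does not mean complex conjugation). A curve on $[0,2\pi]$ is closed if its values at $0$ and at $2\pi$ coincide. *)

theory Defs
  imports "HOL-Analysis.Analysis"
begin

(* The library's analytic_on is for functions of a complex variable. The power series is
   only required to represent f on S near x, so at an endpoint of a nondegenerate closed
   interval this is a one-sided condition; a power series converging on one side of its
   centre converges on both, so f then extends analytically past the endpoint. *)
definition real_analytic_on :: "(real \<Rightarrow> 'a::real_normed_vector) \<Rightarrow> real set \<Rightarrow> bool"
    (infixl "(real'_analytic'_on)" 50) where
  "f real_analytic_on S \<longleftrightarrow>
     (\<forall>x\<in>S. \<exists>c r. r > 0 \<and>
        (\<forall>y\<in>S. \<bar>y - x\<bar> < r \<longrightarrow> (\<lambda>n. (y - x) ^ n *\<^sub>R c n) sums f y))"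

definition arc_length :: "(real \<Rightarrow> complex) \<Rightarrow> real \<Rightarrow> real" where
  "arc_length \<gamma> t = integral {0..t} (\<lambda>u. norm (vector_derivative \<gamma> (at u)))"

definition arc_length_inv :: "(real \<Rightarrow> complex) \<Rightarrow> real \<Rightarrow> real" where
  "arc_length_inv \<gamma> = the_inv_into {0..2 * pi} (arc_length \<gamma>)"

end

theory Submission
  imports Defs "HOL-Complex_Analysis.Complex_Analysis"
begin

text \<open>
  Write \<open>C t\<close> for the integral of \<open>\<gamma>' u * exp (\<i> * lam * cos (M * u))\<close> over \<open>u\<close> from \<open>0\<close> to \<open>t\<close>.
  Since \<open>exp (\<i> * \<theta> t)\<close> is \<open>\<gamma>' t\<close> divided by the speed, the substitution \<open>\<sigma> = arc_length \<gamma> t\<close> turns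
  the deformed curve \<open>c\<close> into \<open>C\<close> composed with the inverse of arc length; the turning
  angle disappears. Both claims are then statements about \<open>C\<close>.

  Closedness: \<open>c (2 * pi) = C (2 * pi)\<close> integrates \<open>\<gamma>'\<close> against a weight of period \<open>2 * pi / M\<close>
  over a full period, so \<open>\<gamma>'\<close> may be replaced by its average over the \<open>M\<close> shifts by multiples of
  \<open>2 * pi / M\<close> (\<open>integral_deriv_of_balanced_eq_0\<close>). Averaging a trigonometric series over these
  shifts keeps exactly the frequencies divisible by \<open>M\<close>, because the powers of a nontrivial \<open>M\<close>-th
  root of unity sum to zero. These frequencies are absent from \<open>\<gamma>\<close>, so the shifted copies of \<open>\<gamma>\<close>
  sum to zero (\<open>trig_series_sum_shifts\<close>), hence so do those of \<open>\<gamma>'\<close>. Pointwise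
  convergence of the Fourier series suffices: only finite sums of series are formed, and the
  derivative is taken of an identically vanishing function.

  Analyticity: a function is analytic near a real point iff it is locally the restriction of a
  holomorphic function, and all constructions involved preserve this. The speed extends as the square
  root of \<open>\<gamma>' * cnj \<gamma>'\<close>, which is nonzero by regularity; arc length and \<open>C\<close> are primitives
  (\<open>hol_ext_primitive\<close>); the holomorphic inverse function theorem inverts arc length
  (\<open>hol_ext_compose_inverse\<close>).
\<close>

section \<open>Real analyticity as local holomorphic extendability\<close>

text \<open>
  The parameter set \<open>S\<close> is kept so that the notion is one-sided at an endpoint of an interval, as is
  real analyticity there.
\<close>
definition hol_ext :: "(real \<Rightarrow> complex) \<Rightarrow> real set \<Rightarrow> real \<Rightarrow> bool" where
  "hol_ext f S x \<longleftrightarrow>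
     (\<exists>r>0. \<exists>F. F holomorphic_on ball (of_real x) r \<and>
        (\<forall>y\<in>S. \<bar>y - x\<bar> < r \<longrightarrow> F (of_real y) = f y))"

lemma of_real_mem_ball: "complex_of_real y \<in> ball (of_real x) r \<longleftrightarrow> \<bar>y - x\<bar> < r"
  by (metis abs_minus_commute dist_norm mem_ball norm_of_real of_real_diff)

text \<open>
  A power series that converges at all real points closer than \<open>r\<close> to its centre converges on the
  complex disc of radius \<open>r\<close>.
\<close>
lemma hol_ext_real_analytic:
  assumes "f real_analytic_on UNIV"
  shows "hol_ext f UNIV x"
proof -
  obtain c r where r: "r > 0"
    and c: "\<And>y. \<bar>y - x\<bar> < r \<Longrightarrow> (\<lambda>n. (y - x) ^ n *\<^sub>R c n) sums f y"
    using assms unfolding real_analytic_on_def by blast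
  define F where "F z = (\<Sum>n. c n * (z - of_real x) ^ n)" for z
  have sm: "summable (\<lambda>n. c n * (z - of_real x) ^ n)" if z: "z \<in> ball (of_real x) r" for z
  proof -
    obtain q where q: "norm (z - of_real x) < q" "q < r"
      using z by (metis dense dist_commute dist_norm mem_ball)
    have q0: "q > 0" using q by (meson le_less_trans norm_ge_zero)
    have "summable (\<lambda>n. q ^ n *\<^sub>R c n)"
      using sums_summable[OF c[of "x + q"]] q q0 by simp
    then have "summable (\<lambda>n. c n * of_real q ^ n)"
      by (simp add: scaleR_conv_of_real mult.commute)
    then show ?thesis
      by (rule powser_inside) (use q q0 in simp)
  qed
  have "F holomorphic_on ball (of_real x) r"
    by (rule power_series_holomorphic[where a = c])
       (simp add: F_def summable_sums sm del: mem_ball)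
  moreover have "F (of_real y) = f y" if "\<bar>y - x\<bar> < r" for y
    using c[OF that] unfolding F_def
    by (simp add: scaleR_conv_of_real mult.commute sums_iff)
  ultimately show ?thesis
    unfolding hol_ext_def using r by blast
qed

text \<open>The Taylor series of a holomorphic extension is the required power series.\<close>
lemma real_analytic_on_hol_ext:
  assumes "\<And>x. x \<in> S \<Longrightarrow> hol_ext f S x"
  shows "f real_analytic_on S"
  unfolding real_analytic_on_def
proof
  fix x assume "x \<in> S"
  then obtain r F where r: "r > 0" and F: "F holomorphic_on ball (of_real x) r"
    and eq: "\<And>y. y \<in> S \<Longrightarrow> \<bar>y - x\<bar> < r \<Longrightarrow> F (of_real y) = f y"
    using assms unfolding hol_ext_def by blast
  have "(\<lambda>n. (y - x) ^ n *\<^sub>R ((deriv ^^ n) F (of_real x) / fact n)) sums f y"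
    if "y \<in> S" "\<bar>y - x\<bar> < r" for y
    using holomorphic_power_series[OF F, of "of_real y"] that
    by (simp add: of_real_mem_ball eq scaleR_conv_of_real mult.commute del: mem_ball)
  then show "\<exists>c r. r > 0 \<and> (\<forall>y\<in>S. \<bar>y - x\<bar> < r \<longrightarrow> (\<lambda>n. (y - x) ^ n *\<^sub>R c n) sums f y)"
    using r by (intro exI[of _ "\<lambda>n. (deriv ^^ n) F (of_real x) / fact n"] exI[of _ r]) simp
qed

lemma hol_ext_cong:
  assumes "hol_ext f S x" and "\<And>y. y \<in> S \<Longrightarrow> f y = g y"
  shows "hol_ext g S x"
  using assms unfolding hol_ext_def by metis

lemma hol_ext_subset: "hol_ext f S x \<Longrightarrow> T \<subseteq> S \<Longrightarrow> hol_ext f T x"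
  unfolding hol_ext_def by blast

lemma hol_ext_holomorphic: "F holomorphic_on UNIV \<Longrightarrow> hol_ext (\<lambda>t. F (of_real t)) S x"
  unfolding hol_ext_def
  by (intro exI[of _ 1] exI[of _ F] conjI) (auto intro: holomorphic_on_subset)

section \<open>Operations preserving holomorphic extendability\<close>

lemma hol_ext_mult:
  assumes "hol_ext f S x" "hol_ext g S x"
  shows "hol_ext (\<lambda>t. f t * g t) S x"
proof -
  obtain r F where r: "r > 0" and F: "F holomorphic_on ball (of_real x) r"
    and f: "\<And>y. y \<in> S \<Longrightarrow> \<bar>y - x\<bar> < r \<Longrightarrow> F (of_real y) = f y"
    using assms(1) unfolding hol_ext_def by blast
  obtain q G where q: "q > 0" and G: "G holomorphic_on ball (of_real x) q"
    and g: "\<And>y. y \<in> S \<Longrightarrow> \<bar>y - x\<bar> < q \<Longrightarrow> G (of_real y) = g y"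
    using assms(2) unfolding hol_ext_def by blast
  have "(\<lambda>z. F z * G z) holomorphic_on ball (of_real x) (min r q)"
    by (intro holomorphic_intros holomorphic_on_subset[OF F] holomorphic_on_subset[OF G]) auto
  then show ?thesis
    unfolding hol_ext_def
    by (intro exI[of _ "min r q"] exI[of _ "\<lambda>z. F z * G z"] conjI) (use r q f g in auto)
qed

text \<open>Conjugation is not holomorphic, but Schwarz reflection of the extension is.\<close>
lemma hol_ext_cnj:
  assumes "hol_ext f S x"
  shows "hol_ext (\<lambda>t. cnj (f t)) S x"
proof -
  obtain r F where r: "r > 0" and F: "F holomorphic_on ball (of_real x) r"
    and f: "\<And>y. y \<in> S \<Longrightarrow> \<bar>y - x\<bar> < r \<Longrightarrow> F (of_real y) = f y"
    using assms unfolding hol_ext_def by blast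
  have "cnj ` ball (of_real x) r \<subseteq> ball (of_real x) r"
    by (auto simp: dist_norm) (metis complex_cnj_complex_of_real complex_cnj_diff complex_mod_cnj)
  then have "(cnj \<circ> F \<circ> cnj) holomorphic_on ball (of_real x) r"
    by (intro holomorphic_on_compose_cnj_cnj holomorphic_on_subset[OF F]) auto
  then show ?thesis
    unfolding hol_ext_def
    by (intro exI[of _ r] exI[of _ "cnj \<circ> F \<circ> cnj"] conjI) (use r f in auto)
qed

text \<open>
  The norm is the square root of \<open>f * cnj f\<close>, whose extension is positive at the point \<open>x\<close> and
  hence avoids the branch cut of the principal square root nearby.
\<close>
lemma hol_ext_norm:
  assumes "hol_ext f S x" and "f x \<noteq> 0" and "x \<in> S"
  shows "hol_ext (\<lambda>t. complex_of_real (norm (f t))) S x"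
proof -
  obtain r F where r: "r > 0" and F: "F holomorphic_on ball (of_real x) r"
    and f: "\<And>y. y \<in> S \<Longrightarrow> \<bar>y - x\<bar> < r \<Longrightarrow> F (of_real y) = f y * cnj (f y)"
    using hol_ext_mult[OF assms(1) hol_ext_cnj[OF assms(1)]] unfolding hol_ext_def by blast
  have "open {z \<in> ball (of_real x) r. F z \<in> - \<real>\<^sub>\<le>\<^sub>0}"
  proof -
    have "open (ball (of_real x) r \<inter> F -` (- \<real>\<^sub>\<le>\<^sub>0))"
      by (intro continuous_open_preimage holomorphic_on_imp_continuous_on[OF F] open_ball open_Compl
            closed_nonpos_Reals_complex)
    also have "ball (of_real x) r \<inter> F -` (- \<real>\<^sub>\<le>\<^sub>0) = {z \<in> ball (of_real x) r. F z \<in> - \<real>\<^sub>\<le>\<^sub>0}"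
      by blast
    finally show ?thesis .
  qed
  moreover have "of_real x \<in> {z \<in> ball (of_real x) r. F z \<in> - \<real>\<^sub>\<le>\<^sub>0}"
    using r assms f[of x] by (simp flip: complex_norm_square of_real_power)
  ultimately obtain q where q: "q > 0" "ball (of_real x) q \<subseteq> {z \<in> ball (of_real x) r. F z \<in> - \<real>\<^sub>\<le>\<^sub>0}"
    by (metis open_contains_ball)
  have "(\<lambda>z. csqrt (F z)) holomorphic_on ball (of_real x) q"
    by (intro holomorphic_intros holomorphic_on_subset[OF F]) (use q in auto)
  moreover have "csqrt (F (of_real y)) = of_real (norm (f y))" if "y \<in> S" "\<bar>y - x\<bar> < q" for y
  proof -
    have "complex_of_real y \<in> ball (of_real x) r"
      using q(2) that(2) of_real_mem_ball[of y x q] by blast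
    then have "F (of_real y) = f y * cnj (f y)"
      using f that by (simp add: of_real_mem_ball del: mem_ball)
    also have "\<dots> = (of_real (norm (f y)))\<^sup>2"
      by (metis complex_norm_square of_real_power)
    finally show ?thesis
      by (simp flip: of_real_power)
  qed
  ultimately show ?thesis
    unfolding hol_ext_def using q by blast
qed

lemma hol_ext_has_vector_derivative:
  assumes "hol_ext f UNIV x"
  shows "(f has_vector_derivative vector_derivative f (at x)) (at x)"
    and "hol_ext (\<lambda>t. vector_derivative f (at t)) UNIV x"
proof -
  obtain r F where r: "r > 0" and F: "F holomorphic_on ball (of_real x) r"
    and f: "\<And>y. \<bar>y - x\<bar> < r \<Longrightarrow> F (of_real y) = f y"
    using assms unfolding hol_ext_def by blast
  have D: "(f has_vector_derivative deriv F (of_real y)) (at y)" if y: "\<bar>y - x\<bar> < r" for y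
  proof -
    have "(F has_field_derivative deriv F (of_real y)) (at (of_real y))"
      using holomorphic_derivI[OF F open_ball] y of_real_mem_ball by blast
    then have "((\<lambda>t. F (of_real t)) has_vector_derivative deriv F (of_real y)) (at y)"
      by (rule has_vector_derivative_real_field)
    then show ?thesis
      by (rule has_vector_derivative_transform_within_open[where S = "ball x r"])
         (use y f in \<open>auto simp: dist_real_def abs_minus_commute\<close>)
  qed
  then show "(f has_vector_derivative vector_derivative f (at x)) (at x)"
    using D[of x] r vector_derivative_at by fastforce
  have "deriv F holomorphic_on ball (of_real x) r"
    by (intro holomorphic_deriv F) auto
  then show "hol_ext (\<lambda>t. vector_derivative f (at t)) UNIV x"
    unfolding hol_ext_def using r D vector_derivative_at by metis
qed

lemma hol_ext_continuous:
  assumes "hol_ext f UNIV x"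
  shows "isCont f x"
  using has_vector_derivative_continuous hol_ext_has_vector_derivative(1)[OF assms] by blast

text \<open>
  A primitive of the holomorphic extension on a disc has the same derivative as \<open>G\<close> along the real
  points of \<open>S\<close>; convexity of \<open>S\<close> makes their difference a constant, which is then added.
\<close>
lemma hol_ext_primitive:
  assumes "hol_ext f S x" "x \<in> S" "convex S"
    and G: "\<And>t. t \<in> S \<Longrightarrow> (G has_vector_derivative f t) (at t within S)"
  shows "hol_ext G S x"
proof -
  obtain r F where r: "r > 0" and F: "F holomorphic_on ball (of_real x) r"
    and f: "\<And>y. y \<in> S \<Longrightarrow> \<bar>y - x\<bar> < r \<Longrightarrow> F (of_real y) = f y"
    using assms(1) unfolding hol_ext_def by blast
  obtain P where P: "\<And>z. z \<in> ball (of_real x) r \<Longrightarrow> (P has_field_derivative F z) (at z within ball (of_real x) r)"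
    using holomorphic_convex_primitive'[OF convex_ball open_ball F] by blast
  define S' where "S' = S \<inter> ball x r"
  have S': "y \<in> S' \<longleftrightarrow> y \<in> S \<and> \<bar>y - x\<bar> < r" for y
    by (auto simp: S'_def dist_real_def abs_minus_commute)
  have "((\<lambda>t. G t - P (of_real t)) has_vector_derivative 0) (at t within S')" if t: "t \<in> S'" for t
  proof -
    have "(P has_field_derivative F (of_real t)) (at (of_real t))"
      using P[of "of_real t"] t by (simp add: S' of_real_mem_ball at_within_open[of _ "ball _ _"] del: mem_ball)
    then have "((\<lambda>u. P (of_real u)) has_vector_derivative F (of_real t)) (at t within S')"
      by (rule has_vector_derivative_real_field)
    moreover have "(G has_vector_derivative f t) (at t within S')"
      by (rule has_vector_derivative_within_subset[OF G]) (use t in \<open>auto simp: S'_def\<close>)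
    ultimately show ?thesis
      using has_vector_derivative_diff[of G "f t" _ "\<lambda>u. P (of_real u)" "F (of_real t)"] f t
      by (simp add: S')
  qed
  moreover have "convex S'"
    using assms(3) by (simp add: S'_def convex_Int)
  ultimately obtain k where k: "\<And>t. t \<in> S' \<Longrightarrow> G t - P (of_real t) = k"
    using has_derivative_zero_constant[of S' "\<lambda>t. G t - P (of_real t)"]
    unfolding has_vector_derivative_def by auto
  have "P holomorphic_on ball (of_real x) r"
    using P unfolding holomorphic_on_def field_differentiable_def by blast
  then have "(\<lambda>z. P z + k) holomorphic_on ball (of_real x) r"
    by (intro holomorphic_intros)
  moreover have "P (of_real y) + k = G y" if "y \<in> S" "\<bar>y - x\<bar> < r" for y
    using k[of y] that by (simp add: S' algebra_simps)
  ultimately show ?thesis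
    unfolding hol_ext_def using r by blast
qed

text \<open>
  An inverse function theorem in the form needed for reparametrisation: \<open>l\<close> extends to a
  holomorphic function with nonzero derivative, which has a local holomorphic inverse \<open>K\<close>. Continuity of
  \<open>g\<close> ensures that near \<open>s\<close> the points \<open>g s'\<close> lie in the disc where the extension is injective,
  so that \<open>K\<close> extends \<open>g\<close>. Differentiating \<open>l\<close> within the interval
  determines the complex derivative even when \<open>x\<close> is an endpoint.
\<close>
lemma hol_ext_compose_inverse:
  fixes l g :: "real \<Rightarrow> real"
  assumes "a < b" and x: "x \<in> {a..b}"
    and extG: "hol_ext G {a..b} x" and extl: "hol_ext (\<lambda>t. of_real (l t)) {a..b} x"
    and l: "(l has_real_derivative d) (at x within {a..b})" "d \<noteq> 0"
    and g: "continuous_on T g" "g ` T \<subseteq> {a..b}" "\<And>s. s \<in> T \<Longrightarrow> l (g s) = s"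
    and s: "s \<in> T" "g s = x"
  shows "hol_ext (\<lambda>s. G (g s)) T s"
proof -
  obtain r1 H where r1: "r1 > 0" and H: "H holomorphic_on ball (of_real x) r1"
    and G: "\<And>y. y \<in> {a..b} \<Longrightarrow> \<bar>y - x\<bar> < r1 \<Longrightarrow> H (of_real y) = G y"
    using extG unfolding hol_ext_def by blast
  obtain r2 L where r2: "r2 > 0" and L: "L holomorphic_on ball (of_real x) r2"
    and Ll: "\<And>y. y \<in> {a..b} \<Longrightarrow> \<bar>y - x\<bar> < r2 \<Longrightarrow> L (of_real y) = of_real (l y)"
    using extl unfolding hol_ext_def by blast
  have "(L has_field_derivative deriv L (of_real x)) (at (of_real x))"
    using holomorphic_derivI[OF L open_ball] r2 by simp
  then have "((\<lambda>u. L (of_real u)) has_vector_derivative deriv L (of_real x)) (at x within {a..b})"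
    by (rule has_vector_derivative_real_field)
  then have "((\<lambda>u. complex_of_real (l u)) has_vector_derivative deriv L (of_real x)) (at x within {a..b})"
    by (rule has_vector_derivative_transform_within[OF _ r2 x]) (simp add: Ll dist_real_def)
  moreover have "((\<lambda>u. complex_of_real (l u)) has_vector_derivative of_real d) (at x within {a..b})"
    using l(1) by (intro has_vector_derivative_of_real) 
  ultimately have "deriv L (of_real x) = of_real d"
    using vector_derivative_unique_within_closed_interval[OF assms(1), of x] x by (auto simp flip: box_real)
  then have dnz: "deriv L (of_real x) \<noteq> 0"
    using l by simp
  define r where "r = min r1 r2"
  have L': "L holomorphic_on ball (of_real x) r"
    by (rule holomorphic_on_subset[OF L]) (auto simp: r_def)
  obtain q where q: "q > 0" "ball (of_real x) q \<subseteq> ball (complex_of_real x) r"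
      and inj: "inj_on L (ball (of_real x) q)"
    using has_complex_derivative_locally_injective[OF L' _ open_ball dnz] r1 r2
    by (auto simp: r_def)
  have L'': "L holomorphic_on ball (of_real x) q"
    by (rule holomorphic_on_subset[OF L' q(2)])
  obtain K where K: "K holomorphic_on L ` ball (of_real x) q"
    and KL: "\<And>z. z \<in> ball (of_real x) q \<Longrightarrow> K (L z) = z"
    using holomorphic_has_inverse[OF L'' open_ball inj] by metis
  have sx: "L (of_real x) = of_real s"
    using Ll[OF x] r2 g(3)[OF s(1)] s(2) by simp
  have "open (L ` ball (of_real x) q)"
    by (rule open_mapping_thm3[OF L'' open_ball inj])
  moreover have "of_real s \<in> L ` ball (of_real x) q"
    using q(1) sx by (metis centre_in_ball image_eqI)
  ultimately obtain e where e: "e > 0" "ball (of_real s) e \<subseteq> L ` ball (of_real x) q"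
    by (metis open_contains_ball)
  obtain d where d: "d > 0" "\<And>s'. s' \<in> T \<Longrightarrow> \<bar>s' - s\<bar> < d \<Longrightarrow> \<bar>g s' - x\<bar> < q"
    using g(1) s q(1) unfolding continuous_on_iff dist_real_def by metis
  have "K ` ball (of_real s) e \<subseteq> ball (of_real x) r1"
  proof
    fix w assume "w \<in> K ` ball (of_real s) e"
    then obtain z where "z \<in> ball (of_real x) q" "w = K (L z)"
      using e(2) by blast
    then have "w \<in> ball (of_real x) q"
      using KL by simp
    then show "w \<in> ball (of_real x) r1"
      using q(2) by (auto simp: r_def)
  qed
  then have "(H \<circ> K) holomorphic_on ball (of_real s) e"
    by (intro holomorphic_on_compose_gen[OF holomorphic_on_subset[OF K e(2)] H])
  then have hol: "(H \<circ> K) holomorphic_on ball (of_real s) (min e d)"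
    by (rule holomorphic_on_subset) auto
  have eq: "(H \<circ> K) (of_real s') = G (g s')" if s': "s' \<in> T" "\<bar>s' - s\<bar> < min e d" for s'
  proof -
    have gs: "g s' \<in> {a..b}" "\<bar>g s' - x\<bar> < q"
      using s' d(2) g(2) by auto
    then have in_q: "complex_of_real (g s') \<in> ball (of_real x) q"
      by (simp only: of_real_mem_ball)
    then have "\<bar>g s' - x\<bar> < r"
      using q(2) of_real_mem_ball by blast
    then have "\<bar>g s' - x\<bar> < r1" "\<bar>g s' - x\<bar> < r2"
      by (auto simp: r_def)
    then have "L (of_real (g s')) = of_real s'" "H (of_real (g s')) = G (g s')"
      using Ll G gs g(3) s' by auto
    then show ?thesis
      using KL[OF in_q] by simp
  qed
  show ?thesis
    unfolding hol_ext_def using hol eq e(1) d(1) by (intro exI[of _ "min e d"]) auto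
qed

section \<open>Averaging over shifts\<close>

text \<open>
  Both identities are the real and imaginary part of a geometric sum over the \<open>M\<close>-th root of unity
  \<open>w\<close>, which differs from \<open>1\<close> exactly because \<open>M\<close> does not divide \<open>j\<close>.
\<close>
lemma sum_trig_shifts:
  assumes "M \<ge> 1" "\<not> M dvd j"
  shows "(\<Sum>k<M. cos (real j * (t + 2 * pi * real k / real M))) = 0"
    and "(\<Sum>k<M. sin (real j * (t + 2 * pi * real k / real M))) = 0"
proof -
  define w where "w = cis (2 * pi * real j / real M)"
  have "real M * (2 * pi * real j / real M) = 2 * pi * real j"
    using assms(1) by simp
  then have "w ^ M = cis (2 * pi * real j)"
    unfolding w_def Complex.DeMoivre by (simp only:)
  then have "w ^ M = 1"
    by simp
  moreover have "w \<noteq> 1"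
  proof -
    have "w = exp (2 * of_real pi * \<i> * (of_nat j / of_nat M))"
      by (simp add: w_def cis_conv_exp mult_ac)
    then show ?thesis
      using complex_root_unity_eq_1[OF assms(1), of j] assms(2) by simp
  qed
  ultimately have "(\<Sum>k<M. w ^ k) = 0"
    by (simp add: geometric_sum)
  then have "(\<Sum>k<M. cis (real j * t) * w ^ k) = 0"
    by (simp flip: sum_distrib_left)
  moreover have "cis (real j * t) * w ^ k = cis (real j * (t + 2 * pi * real k / real M))" for k
    by (simp add: w_def Complex.DeMoivre cis_mult algebra_simps)
  ultimately have *: "(\<Sum>k<M. cis (real j * (t + 2 * pi * real k / real M))) = 0"
    by simp
  show "(\<Sum>k<M. cos (real j * (t + 2 * pi * real k / real M))) = 0"
    using arg_cong[OF *, of Re] by simp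
  show "(\<Sum>k<M. sin (real j * (t + 2 * pi * real k / real M))) = 0"
    using arg_cong[OF *, of Im] by simp
qed

lemma trig_series_sum_shifts:
  assumes "M \<ge> 1"
    and f: "\<And>t. (\<lambda>j. a j * cos (real j * t) + b j * sin (real j * t)) sums f t"
    and z: "\<And>j. M dvd j \<Longrightarrow> a j = 0 \<and> b j = 0"
  shows "(\<Sum>k<M. f (t + 2 * pi * real k / real M)) = 0"
proof -
  let ?u = "\<lambda>k. t + 2 * pi * real k / real M"
  have "(\<lambda>j. \<Sum>k<M. a j * cos (real j * ?u k) + b j * sin (real j * ?u k)) sums (\<Sum>k<M. f (?u k))"
    by (intro sums_sum f)
  moreover have "(\<Sum>k<M. a j * cos (real j * ?u k) + b j * sin (real j * ?u k)) = 0" for j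
  proof (cases "M dvd j")
    case False
    then show ?thesis
      unfolding sum.distrib sum_distrib_left[symmetric] sum_trig_shifts[OF assms(1) False] by simp
  qed (simp add: z)
  ultimately show ?thesis
    using sums_unique2[OF sums_zero] by fastforce
qed

text \<open>
  Both sides complete to the integral over \<open>{0..p + c}\<close> by adding an integral over an interval of
  length \<open>c\<close>, and the two added integrals agree by periodicity.
\<close>
lemma integral_periodic_shift:
  fixes f :: "real \<Rightarrow> complex"
  assumes cont: "continuous_on UNIV f" and per: "\<And>t. f (t + p) = f t" and "c \<ge> 0" "p \<ge> 0"
  shows "integral {0..p} (\<lambda>t. f (t + c)) = integral {0..p} f"
proof -
  have int: "f integrable_on {u..v}" for u v
    by (intro integrable_continuous_real continuous_on_subset[OF cont]) auto
  have "integral {0..p} (\<lambda>t. f (t + c)) = integral {c..p + c} f"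
    using integral_shift[of 0 c p f] continuous_on_subset[OF cont] by (simp add: o_def)
  moreover have "integral {0..p} f + integral {p..p + c} f = integral {0..c} f + integral {c..p + c} f"
    using assms int by (simp add: Henstock_Kurzweil_Integration.integral_combine)
  moreover have "integral {p..p + c} f = integral {0..c} f"
    using integral_shift[of 0 p c f] continuous_on_subset[OF cont]
    by (simp add: o_def per add.commute)
  ultimately show ?thesis by simp
qed


text \<open>
  Shifting the variable by \<open>p * k / M\<close> does not change the integral, and the weight \<open>g\<close> does not see the
  shift. Hence \<open>M\<close> times the integral equals the integral of the weight against the
  sum of the shifted derivatives, which is the derivative of the zero function.
\<close>
lemma integral_deriv_of_balanced_eq_0:
  fixes \<gamma> v g :: "real \<Rightarrow> complex"
  assumes M: "M \<ge> 1"
    and v: "\<And>t. (\<gamma> has_vector_derivative v t) (at t)" "continuous_on UNIV v"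
    and per: "\<And>t. \<gamma> (t + p) = \<gamma> t" "p \<ge> 0"
    and bal: "\<And>t. (\<Sum>k<M. \<gamma> (t + p * real k / real M)) = 0"
    and g: "continuous_on UNIV g" "\<And>t. g (t + p / real M) = g t"
  shows "integral {0..p} (\<lambda>t. v t * g t) = 0"
proof -
  let ?s = "\<lambda>k. p * real k / real M"
  have shift: "((\<lambda>u. \<gamma> (u + c)) has_vector_derivative v (t + c)) (at t)" for t c
  proof -
    have "((\<lambda>u. u + c) has_vector_derivative 1) (at t)"
      by (auto intro!: derivative_eq_intros simp flip: has_real_derivative_iff_has_vector_derivative)
    then show ?thesis
      using vector_diff_chain_at[of "\<lambda>u. u + c" 1 t \<gamma> "v (t + c)"] v(1) by (simp add: o_def)
  qed
  have "v (t + p) = v t" for t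
    using shift[of p t] v(1)[of t] per(1) vector_derivative_unique_at by force
  moreover have gs: "g (t + ?s k) = g t" for t k
  proof (induction k)
    case (Suc k)
    have "t + ?s (Suc k) = (t + ?s k) + p / real M"
      by (simp add: add_divide_distrib distrib_left)
    then show ?case using g(2)[of "t + ?s k"] Suc by metis
  qed simp
  have "g (t + p) = g t" for t
    using gs[of t M] M by simp
  ultimately have perw: "v (t + p) * g (t + p) = v t * g t" for t
    by simp
  have contw: "continuous_on UNIV (\<lambda>t. v t * g t)"
    by (intro continuous_intros v g)
  have one: "integral {0..p} (\<lambda>t. v (t + ?s k) * g t) = integral {0..p} (\<lambda>t. v t * g t)" for k
    using integral_periodic_shift[OF contw perw, of "?s k"] per(2) by (simp add: gs)
  have zero: "(\<Sum>k<M. v (t + ?s k)) = 0" for t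
  proof -
    have "((\<lambda>u. \<Sum>k<M. \<gamma> (u + ?s k)) has_vector_derivative (\<Sum>k<M. v (t + ?s k))) (at t)"
      by (intro has_vector_derivative_sum shift)
    then show ?thesis
      using vector_derivative_unique_at[OF _ has_vector_derivative_const] by (simp add: bal)
  qed
  have "of_nat M * integral {0..p} (\<lambda>t. v t * g t) = (\<Sum>k<M. integral {0..p} (\<lambda>t. v (t + ?s k) * g t))"
    by (simp add: one)
  also have "\<dots> = integral {0..p} (\<lambda>t. \<Sum>k<M. v (t + ?s k) * g t)"
    by (intro integral_sum[symmetric] integrable_continuous_real continuous_intros g
          continuous_on_subset[OF g(1)] continuous_on_compose2[OF v(2)]) auto
  also have "\<dots> = 0"
    by (simp add: zero flip: sum_distrib_right)
  finally show ?thesis using M by simp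
qed

section \<open>Closed analytic deformations\<close>

theorem mainTheorem3:
  fixes M :: nat
    and \<gamma> :: "real \<Rightarrow> complex"
    and a b a' b' :: "nat \<Rightarrow> real"
    and \<theta> :: "real \<Rightarrow> real"
  assumes "M \<ge> 1"
    and "\<gamma> real_analytic_on UNIV"
    and "\<forall>t. \<gamma> (t + 2 * pi) = \<gamma> t"
    and "\<forall>t. vector_derivative \<gamma> (at t) \<noteq> 0"
    and "arc_length \<gamma> (2 * pi) = 2 * pi"
    and "\<forall>t. (\<lambda>j. a j * cos (real j * t) + b j * sin (real j * t)) sums Re (\<gamma> t)"
    and "\<forall>t. (\<lambda>j. a' j * cos (real j * t) + b' j * sin (real j * t)) sums Im (\<gamma> t)"
    and "\<forall>j. M dvd j \<longrightarrow> a j = 0 \<and> b j = 0 \<and> a' j = 0 \<and> b' j = 0"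
    and "continuous_on UNIV \<theta>"
    and "\<forall>t. vector_derivative \<gamma> (at t) =
               complex_of_real (norm (vector_derivative \<gamma> (at t))) * exp (\<i> * complex_of_real (\<theta> t))"
  shows "\<forall>lam::real.
    let t = arc_length_inv \<gamma>;
        c = (\<lambda>s. integral {0..s}
               (\<lambda>\<sigma>. exp (\<i> * complex_of_real (\<theta> (t \<sigma>) + lam * cos (real M * t \<sigma>)))))
    in c real_analytic_on {0..2 * pi} \<and> c 0 = c (2 * pi)"
proof
  fix lam :: real
  define v where "v t = vector_derivative \<gamma> (at t)" for t
  define l where "l = arc_length \<gamma>"
  define g where "g = arc_length_inv \<gamma>"
  let ?I = "{0..2 * pi}"
  have ext: "hol_ext \<gamma> UNIV x" for x
    using assms(2) by (rule hol_ext_real_analytic)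
  have dv: "(\<gamma> has_vector_derivative v t) (at t)" for t
    unfolding v_def by (rule hol_ext_has_vector_derivative[OF ext])
  have extv: "hol_ext v UNIV t" for t
    unfolding v_def by (rule hol_ext_has_vector_derivative[OF ext])
  have contv: "continuous_on UNIV v"
    using hol_ext_continuous[OF extv] by (simp add: continuous_on_eq_continuous_at)
  have v0: "v t \<noteq> 0" for t
    using assms(4) by (simp add: v_def)
  have dl: "(l has_real_derivative norm (v t)) (at t within ?I)" if "t \<in> ?I" for t
    unfolding l_def arc_length_def[abs_def] v_def[symmetric]
    by (intro integral_has_real_derivative that continuous_intros continuous_on_subset[OF contv]) auto
  have contl: "continuous_on ?I l"
    by (rule DERIV_continuous_on[OF dl])
  have mono: "l x < l y" if "0 \<le> x" "x < y" "y \<le> 2 * pi" for x y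
  proof (rule DERIV_pos_imp_increasing_open[OF that(2)])
    show "\<exists>d. DERIV l u :> d \<and> d > 0" if "x < u" "u < y" for u
      using dl[of u] v0[of u] that \<open>0 \<le> x\<close> \<open>y \<le> 2 * pi\<close>
      by (intro exI[of _ "norm (v u)"]) (auto simp: at_within_Icc_at)
    show "continuous_on {x..y} l"
      by (rule continuous_on_subset[OF contl]) (use that in auto)
  qed
  have inj: "inj_on l ?I"
    by (rule linorder_inj_onI') (use mono in force)
  have l0: "l 0 = 0"
    by (simp add: l_def arc_length_def)
  have l2: "l (2 * pi) = 2 * pi"
    using assms(5) by (simp add: l_def)
  have mono_le: "l x \<le> l y" if "0 \<le> x" "x \<le> y" "y \<le> 2 * pi" for x y
    using mono[of x y] that by (cases "x = y") auto
  have image: "l ` ?I = ?I"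
  proof
    show "l ` ?I \<subseteq> ?I"
      using mono_le[of 0] mono_le[of _ "2 * pi"] l0 l2 by fastforce
    show "?I \<subseteq> l ` ?I"
      using IVT'[of l 0 _ "2 * pi"] contl l0 l2 by fastforce
  qed
  have g_def': "g = the_inv_into ?I l"
    by (simp add: g_def l_def arc_length_inv_def)
  have gl: "g (l t) = t" if "t \<in> ?I" for t
    unfolding g_def' by (rule the_inv_into_f_f[OF inj that])
  have lg: "l (g s) = s" if "s \<in> ?I" for s
    unfolding g_def' by (rule f_the_inv_into_f[OF inj]) (use that image in simp)
  have gI: "g s \<in> ?I" if "s \<in> ?I" for s
    unfolding g_def' by (rule the_inv_into_into[OF inj]) (use that image in auto)
  have contg: "continuous_on ?I g"
    using continuous_on_inv_into[OF contl compact_Icc inj] by (simp add: image g_def')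

  define h where "h t = exp (\<i> * complex_of_real (lam * cos (real M * t)))" for t
  define C where "C t = integral {0..t} (\<lambda>u. v u * h u)" for t
  define c where "c s = integral {0..s}
    (\<lambda>\<sigma>. exp (\<i> * complex_of_real (\<theta> (g \<sigma>) + lam * cos (real M * g \<sigma>))))" for s
  have conth: "continuous_on UNIV h"
    unfolding h_def by (intro continuous_intros)
  \<comment> \<open>Substituting arc length for \<open>\<sigma>\<close> recombines the speed and \<open>exp (\<i> * \<theta>)\<close> into \<open>\<gamma>'\<close>.\<close>
  have cC: "C (g s) = c s" if s: "s \<in> ?I" for s
  proof -
    let ?f = "\<lambda>\<sigma>. exp (\<i> * complex_of_real (\<theta> (g \<sigma>) + lam * cos (real M * g \<sigma>)))"
    have sub: "{0..g s} \<subseteq> ?I" using gI[OF s] by auto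
    have "((\<lambda>x. norm (v x) *\<^sub>R ?f (l x)) has_integral integral {l 0..l (g s)} ?f) {0..g s}"
    proof (rule has_integral_substitution)
      show "0 \<le> g s" "l 0 \<le> l (g s)" "l ` {0..g s} \<subseteq> ?I"
        using gI[OF s] lg[OF s] s l0 image sub by auto
      show "continuous_on ?I ?f"
        by (intro continuous_intros contg continuous_on_compose2[OF assms(9) contg]) auto
      show "(l has_field_derivative norm (v x)) (at x within {0..g s})" if "x \<in> {0..g s}" for x
        using DERIV_subset[OF dl sub] sub that by blast
    qed
    moreover have "norm (v x) *\<^sub>R ?f (l x) = v x * h x" if "x \<in> {0..g s}" for x
      using assms(10)[rule_format, of x] gl[of x] sub that
      by (simp add: v_def[symmetric] h_def scaleR_conv_of_real distrib_left exp_add subset_iff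
            flip: mult.assoc)
    ultimately have "((\<lambda>x. v x * h x) has_integral integral {l 0..l (g s)} ?f) {0..g s}"
      by (rule has_integral_eq[rotated])
    then show ?thesis
      unfolding C_def c_def by (simp add: l0 lg[OF s] integral_unique)
  qed

  have "c real_analytic_on ?I"
  proof (rule real_analytic_on_hol_ext)
    fix s assume s: "s \<in> ?I"
    let ?x = "g s"
    have x: "?x \<in> ?I" by (rule gI[OF s])
    have "hol_ext h UNIV ?x"
    proof -
      have "(\<lambda>z. exp (\<i> * (of_real lam * cos (of_nat M * z)))) holomorphic_on UNIV"
        by (intro holomorphic_intros)
      from hol_ext_holomorphic[OF this] show ?thesis
        unfolding h_def by (simp flip: cos_of_real)
    qed
    then have "hol_ext (\<lambda>t. v t * h t) ?I ?x"
      by (intro hol_ext_subset[OF hol_ext_mult[OF extv]]) auto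
    then have extC: "hol_ext C ?I ?x"
    proof (rule hol_ext_primitive[OF _ x convex_real_interval(5)])
      show "(C has_vector_derivative v t * h t) (at t within ?I)" if "t \<in> ?I" for t
        unfolding C_def using that
        by (intro integral_has_vector_derivative continuous_intros continuous_on_subset[OF contv]
              continuous_on_subset[OF conth]) auto
    qed
    have "hol_ext (\<lambda>t. complex_of_real (norm (v t))) ?I ?x"
      by (rule hol_ext_subset[OF hol_ext_norm[OF extv v0]]) auto
    then have extl: "hol_ext (\<lambda>t. of_real (l t)) ?I ?x"
      by (rule hol_ext_primitive[OF _ x convex_real_interval(5)])
         (intro has_vector_derivative_of_real dl)
    have "hol_ext (\<lambda>s. C (g s)) ?I s"
      by (rule hol_ext_compose_inverse[OF _ x extC extl dl[OF x]])
         (use v0 contg gI lg s in auto)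
    then show "hol_ext c ?I s"
      by (rule hol_ext_cong) (rule cC)
  qed
  moreover have "c (2 * pi) = 0"
  proof -
    have bal: "(\<Sum>k<M. \<gamma> (t + 2 * pi * real k / real M)) = 0" for t
    proof (rule complex_eqI)
      have "(\<Sum>k<M. Re (\<gamma> (t + 2 * pi * real k / real M))) = 0"
        by (rule trig_series_sum_shifts[where f = "\<lambda>t. Re (\<gamma> t)", of M a b]) (use assms(1,6,8) in blast)+
      then show "Re (\<Sum>k<M. \<gamma> (t + 2 * pi * real k / real M)) = Re 0"
        by simp
      have "(\<Sum>k<M. Im (\<gamma> (t + 2 * pi * real k / real M))) = 0"
        by (rule trig_series_sum_shifts[where f = "\<lambda>t. Im (\<gamma> t)", of M a' b']) (use assms(1,7,8) in blast)+
      then show "Im (\<Sum>k<M. \<gamma> (t + 2 * pi * real k / real M)) = Im 0"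
        by simp
    qed
    have "h (t + 2 * pi / real M) = h t" for t
    proof -
      have "real M * (t + 2 * pi / real M) = real M * t + 2 * pi"
        using assms(1) by (simp add: field_simps)
      then show ?thesis by (simp add: h_def)
    qed
    then have "C (2 * pi) = 0"
      unfolding C_def
      by (intro integral_deriv_of_balanced_eq_0[OF assms(1) dv contv _ _ bal conth]) (use assms(3) in auto)
    moreover have "g (2 * pi) = 2 * pi"
      using gl[of "2 * pi"] l2 by simp
    ultimately show ?thesis
      using cC[of "2 * pi"] by simp
  qed
  moreover have "c 0 = 0"
    by (simp add: c_def)
  ultimately have "c real_analytic_on ?I \<and> c 0 = c (2 * pi)"
    by simp
  then show "let t = arc_length_inv \<gamma>;
        c = (\<lambda>s. integral {0..s}
               (\<lambda>\<sigma>. exp (\<i> * complex_of_real (\<theta> (t \<sigma>) + lam * cos (real M * t \<sigma>)))))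
    in c real_analytic_on {0..2 * pi} \<and> c 0 = c (2 * pi)"
    unfolding Let_def g_def[symmetric] c_def[abs_def] .
qed

end
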